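(* Suppose that $m,n\ge 2$. Let $\mathcal{A},\mathcal{B}\in CD_{m,n}$. Then: (i) $\mathcal{A}\circ\mathcal{B}\in CD_{m,n}$. (ii) If $\mathcal{A}\in SCD_{m,n}$ and every diagonal entry of $\mathcal{B}$ is positive, then $\mathcal{A}\circ\mathcal{B}\in SCD_{m,n}$. (iii) If $\mathcal{A},\mathcal{B}\in SCD_{m,n}$, then $\mathcal{A}\circ\mathcal{B}\in SCD_{m,n}$.
   Context: $S_{m,n}$ is the space of real symmetric tensors of order $m$ and dimension $n$. For $\mathbf{u}\in\mathbb{R}^n$, $\mathbf{u}^m\in S_{m,n}$ is the rank-one tensor with entries $u_{i_1}\cdots u_{i_m}$. A tensor $\mathcal{A}\in S_{m,n}$ is completely decomposable (in $CD_{m,n}$) if $\mathcal{A}=\sum_{j=1}^p\mathbf{u}_j^m$ for finitely many $\mathbf{u}_j\in\mathbb{R}^n$; it is strongly completely decomposable (in $SCD_{m,n}$) if such a representation exists with $\mathbf{u}_1,\dots,\mathbf{u}_p$ spanning $\mathbb{R}^n$. $\mathcal{A}\circ\mathcal{B}$ denotes the Hadamard (entrywise) product. The diagonal entries of $\mathcal{B}=(b_{i_1\cdots i_m})$ are $b_{i i\cdots i}$, $i=1,\dots,n$. *)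

theory Defs
  imports "HOL-Analysis.Analysis"
begin

text \<open>
  The type \<open>'m\<close> indexes the tensor positions and \<open>'n\<close> the coordinates, so the order is
  \<open>CARD('m)\<close> and the dimension is \<open>CARD('n)\<close>. The entry of \<open>A\<close> at the multi-index
  \<open>i\<close>, where \<open>i $ k\<close> is the index in position \<open>k\<close>, is \<open>A $ i\<close>.
\<close>

type_synonym ('n, 'm) tensor = "real ^ ('n ^ 'm)"

definition symmetric_tensors :: "('n::finite, 'm::finite) tensor set" where
  "symmetric_tensors =
     {A. \<forall>\<sigma> i. \<sigma> permutes UNIV \<longrightarrow> A $ (\<chi> k. i $ \<sigma> k) = A $ i}"

definition rank_one_tensor :: "real ^ 'n \<Rightarrow> ('n::finite, 'm::finite) tensor" where
  "rank_one_tensor u = (\<chi> i. \<Prod>k\<in>UNIV. u $ (i $ k))"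

definition completely_decomposable :: "('n::finite, 'm::finite) tensor set" where
  "completely_decomposable =
     {A \<in> symmetric_tensors. \<exists>(p::nat) (u :: nat \<Rightarrow> real ^ 'n).
        A = (\<Sum>j<p. rank_one_tensor (u j))}"

definition strongly_completely_decomposable :: "('n::finite, 'm::finite) tensor set" where
  "strongly_completely_decomposable =
     {A \<in> symmetric_tensors. \<exists>(p::nat) (u :: nat \<Rightarrow> real ^ 'n).
        A = (\<Sum>j<p. rank_one_tensor (u j)) \<and> span (u ` {..<p}) = UNIV}"

text \<open>Multiplication on \<open>real ^ 'a\<close> is componentwise, hence the Hadamard product on tensors.\<close>

abbreviation hadamard_product ::
    "('n::finite, 'm::finite) tensor \<Rightarrow> ('n, 'm) tensor \<Rightarrow> ('n, 'm) tensor"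
    (infixl "\<odot>" 70) where
  "A \<odot> B \<equiv> A * B"

definition diagonal_entry :: "('n::finite, 'm::finite) tensor \<Rightarrow> 'n \<Rightarrow> real" where
  "diagonal_entry B a = B $ (\<chi> k. a)"

end

theory Submission imports Defs
begin

text \<open>
  The Hadamard product of rank-one tensors is rank-one: \<open>u\<^sup>m \<odot> v\<^sup>m = (u * v)\<^sup>m\<close>. Expanding
  the product of two sums therefore shows that, if \<open>A\<close> is decomposed by the vectors \<open>u j\<close> and
  \<open>B\<close> by the vectors \<open>v k\<close>, then \<open>A \<odot> B\<close> is decomposed by the componentwise products
  \<open>u j * v k\<close>. This is the first claim.

  For the strong claims it remains to see when these products span. Componentwise multiplication by
  a fixed \<open>v k\<close> is linear, so if the \<open>u j\<close> span the space, the span of the products contains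
  \<open>x * v k\<close> for every vector \<open>x\<close>, in particular the multiple of the \<open>a\<close>-th unit vector by
  \<open>v k $ a\<close>. Hence it suffices that for each coordinate \<open>a\<close> some \<open>v k\<close> is nonzero at \<open>a\<close>
  (\<open>span_componentwise_products\<close>). A positive diagonal entry of \<open>B\<close>, being the sum of the powers
  \<open>(v k $ a) ^ m\<close>, provides such a \<open>k\<close>; so does the assumption that the \<open>v k\<close> span, since
  otherwise they would all lie in a coordinate hyperplane.
\<close>

lemma rank_one_tensor_mult:
  "rank_one_tensor u * rank_one_tensor v = rank_one_tensor (u * v)"
  by (simp add: vec_eq_iff rank_one_tensor_def prod.distrib)

lemma rank_one_tensor_symmetric:
  "rank_one_tensor u \<in> (symmetric_tensors :: ('a::finite, 'b::finite) tensor set)"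
proof -
  have "(\<Prod>k\<in>UNIV. u $ (i $ \<sigma> k)) = (\<Prod>k\<in>UNIV. u $ (i $ k))"
    if "\<sigma> permutes UNIV" for \<sigma> and i :: "'a ^ 'b"
    using prod.permute[OF that, of "\<lambda>k. u $ (i $ k)"] by (simp add: o_def)
  then show ?thesis
    by (simp add: symmetric_tensors_def rank_one_tensor_def)
qed

lemma sum_symmetric_tensors:
  assumes "\<And>x. x \<in> I \<Longrightarrow> f x \<in> symmetric_tensors"
  shows "(\<Sum>x\<in>I. f x) \<in> symmetric_tensors"
  using assms by (auto simp: symmetric_tensors_def)

text \<open>
  Products of decompositions are naturally indexed by pairs; the next lemma allows any finite index
  set in place of an initial segment of the natural numbers.
\<close>

lemma finite_family_decomposable:
  fixes w :: "'i \<Rightarrow> real ^ 'n::finite"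
  defines "T \<equiv> (\<lambda>x. rank_one_tensor (w x) :: ('n, 'm::finite) tensor)"
  assumes "finite I"
  shows "(\<Sum>x\<in>I. T x) \<in> completely_decomposable"
    and "span (w ` I) = UNIV \<Longrightarrow> (\<Sum>x\<in>I. T x) \<in> strongly_completely_decomposable"
proof -
  obtain h where h: "bij_betw h {..<card I} I"
    using ex_bij_betw_nat_finite[OF assms(2)] by (auto simp: atLeast0LessThan)
  have sum_eq: "(\<Sum>x\<in>I. T x) = (\<Sum>j<card I. rank_one_tensor ((w \<circ> h) j))"
    using sum.reindex_bij_betw[OF h, of T] by (simp add: T_def)
  have image_eq: "(w \<circ> h) ` {..<card I} = w ` I"
    using h by (simp add: bij_betw_def flip: image_image image_comp)
  have sym: "(\<Sum>x\<in>I. T x) \<in> symmetric_tensors"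
    unfolding T_def by (intro sum_symmetric_tensors rank_one_tensor_symmetric)
  show "(\<Sum>x\<in>I. T x) \<in> completely_decomposable"
    unfolding completely_decomposable_def using sym sum_eq by blast
  show "(\<Sum>x\<in>I. T x) \<in> strongly_completely_decomposable"
    if "span (w ` I) = UNIV"
  proof -
    have "span ((w \<circ> h) ` {..<card I}) = UNIV"
      using that image_eq by simp
    then show ?thesis
      unfolding strongly_completely_decomposable_def using sym sum_eq by blast
  qed
qed

lemma sum_rank_one_tensor_mult:
  "(\<Sum>j\<in>J. rank_one_tensor (u j)) * (\<Sum>k\<in>K. rank_one_tensor (v k))
     = (\<Sum>(j, k)\<in>J \<times> K. rank_one_tensor (u j * v k))"
  by (simp add: sum_product rank_one_tensor_mult sum.cartesian_product)

text \<open>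
  Multiplication by a fixed vector is linear and thus carries the span of the \<open>u j\<close>, which is
  everything, into the span of the products; applied to a unit vector it only rescales it.
\<close>

lemma span_componentwise_products:
  fixes u :: "'j \<Rightarrow> real ^ 'n" and v :: "'k \<Rightarrow> real ^ 'n"
  assumes span: "span (u ` J) = UNIV"
    and nonzero: "\<And>a. \<exists>k\<in>K. v k $ a \<noteq> 0"
  shows "span ((\<lambda>(j, k). u j * v k) ` (J \<times> K)) = UNIV"
proof -
  let ?S = "span ((\<lambda>(j, k). u j * v k) ` (J \<times> K))"
  have mult_mem: "x * v k \<in> ?S" if "k \<in> K" for x k
  proof -
    have "linear (\<lambda>y. y * v k)"
      by (intro linearI) (simp_all add: algebra_simps vec_eq_iff)
    then have "span ((\<lambda>y. y * v k) ` u ` J) = (\<lambda>y. y * v k) ` UNIV"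
      by (simp only: linear_span_image span)
    moreover have "(\<lambda>y. y * v k) ` u ` J \<subseteq> (\<lambda>(j, k). u j * v k) ` (J \<times> K)"
      using that by force
    ultimately show ?thesis
      using span_mono by blast
  qed
  have "axis a 1 \<in> ?S" for a
  proof -
    obtain k where k: "k \<in> K" "v k $ a \<noteq> 0"
      using nonzero by blast
    have "axis a 1 = (1 / v k $ a) *\<^sub>R (axis a 1 * v k)"
      using k by (auto simp: vec_eq_iff axis_def)
    then show ?thesis
      using span_scale[OF mult_mem[OF k(1)]] by metis
  qed
  then have "Basis \<subseteq> ?S"
    by (auto simp: Basis_vec_def)
  then show ?thesis
    using span_minimal[OF _ subspace_span] by (metis span_Basis top.extremum_uniqueI)
qed

lemma diagonal_entry_sum_rank_one:
  "diagonal_entry (\<Sum>k\<in>K. rank_one_tensor (v k) :: ('n::finite, 'm::finite) tensor) a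
     = (\<Sum>k\<in>K. (v k $ a) ^ CARD('m))"
  by (simp add: diagonal_entry_def rank_one_tensor_def)

lemma nonzero_coordinate_of_positive_diagonal:
  fixes v :: "'k \<Rightarrow> real ^ 'n"
  assumes "diagonal_entry (\<Sum>k\<in>K. rank_one_tensor (v k) :: ('n::finite, 'm::finite) tensor) a > 0"
  shows "\<exists>k\<in>K. v k $ a \<noteq> 0"
proof (rule ccontr)
  assume "\<not> ?thesis"
  then have "(\<Sum>k\<in>K. (v k $ a) ^ CARD('m)) = 0"
    by (intro sum.neutral) auto
  with assms show False
    by (simp add: diagonal_entry_sum_rank_one)
qed

lemma nonzero_coordinate_of_spanning:
  fixes v :: "'k \<Rightarrow> real ^ 'n"
  assumes "span (v ` K) = UNIV"
  shows "\<exists>k\<in>K. v k $ a \<noteq> 0"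
proof (rule ccontr)
  assume "\<not> ?thesis"
  moreover have "subspace {x :: real ^ 'n. x $ a = 0}"
    by (simp add: subspace_def)
  ultimately have "span (v ` K) \<subseteq> {x. x $ a = 0}"
    by (intro span_minimal) auto
  then have "axis a (1::real) $ a = 0"
    unfolding assms by blast
  then show False by simp
qed

lemma hadamard_strongly_completely_decomposable:
  fixes u :: "'j \<Rightarrow> real ^ 'n::finite" and v :: "'k \<Rightarrow> real ^ 'n"
  assumes "finite J" "finite K" "span (u ` J) = UNIV" "\<And>a. \<exists>k\<in>K. v k $ a \<noteq> 0"
  shows "(\<Sum>j\<in>J. rank_one_tensor (u j)) \<odot> (\<Sum>k\<in>K. rank_one_tensor (v k))
    \<in> (strongly_completely_decomposable :: ('n, 'm::finite) tensor set)"
  using finite_family_decomposable(2)[of "J \<times> K" "\<lambda>(j, k). u j * v k"]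
    span_componentwise_products[of u J K v] assms
  by (simp add: sum_rank_one_tensor_mult case_prod_unfold)

theorem theorem4p1:
  fixes A B :: "('n::finite, 'm::finite) tensor"
  assumes "CARD('m) \<ge> 2" and "CARD('n) \<ge> 2"
    and "A \<in> completely_decomposable" and "B \<in> completely_decomposable"
  shows "A \<odot> B \<in> completely_decomposable
    \<and> (A \<in> strongly_completely_decomposable \<and> (\<forall>a. diagonal_entry B a > 0)
         \<longrightarrow> A \<odot> B \<in> strongly_completely_decomposable)
    \<and> (A \<in> strongly_completely_decomposable \<and> B \<in> strongly_completely_decomposable
         \<longrightarrow> A \<odot> B \<in> strongly_completely_decomposable)"
proof -
  obtain q and v :: "nat \<Rightarrow> real ^ 'n" where B: "B = (\<Sum>k<q. rank_one_tensor (v k))"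
    using assms(4) by (simp add: completely_decomposable_def) blast
  have weak: "A \<odot> B \<in> completely_decomposable"
  proof -
    obtain p and u :: "nat \<Rightarrow> real ^ 'n" where A: "A = (\<Sum>j<p. rank_one_tensor (u j))"
      using assms(3) by (simp add: completely_decomposable_def) blast
    show ?thesis
      using finite_family_decomposable(1)[of "{..<p} \<times> {..<q}" "\<lambda>(j, k). u j * v k"]
      by (simp add: A B sum_rank_one_tensor_mult case_prod_unfold)
  qed
  have strong: "A \<odot> B \<in> strongly_completely_decomposable"
    if A: "A \<in> strongly_completely_decomposable" and w: "B = (\<Sum>k<r. rank_one_tensor (w k))"
      "\<And>a. \<exists>k\<in>{..<r}. w k $ a \<noteq> 0" for r and w :: "nat \<Rightarrow> real ^ 'n"
  proof -
    obtain p and u :: "nat \<Rightarrow> real ^ 'n"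
      where "A = (\<Sum>j<p. rank_one_tensor (u j))" "span (u ` {..<p}) = UNIV"
      using A by (simp add: strongly_completely_decomposable_def) blast
    with w show ?thesis
      by (simp add: hadamard_strongly_completely_decomposable)
  qed
  have "A \<odot> B \<in> strongly_completely_decomposable"
    if "A \<in> strongly_completely_decomposable" "\<forall>a. diagonal_entry B a > 0"
    using strong[OF that(1) B] nonzero_coordinate_of_positive_diagonal that(2) B by blast
  moreover have "A \<odot> B \<in> strongly_completely_decomposable"
    if A: "A \<in> strongly_completely_decomposable" and B: "B \<in> strongly_completely_decomposable"
  proof -
    \<comment> \<open>The decomposition of \<open>B\<close> fixed above need not span, so a spanning one is chosen.\<close>
    obtain r and w :: "nat \<Rightarrow> real ^ 'n"
      where w: "B = (\<Sum>k<r. rank_one_tensor (w k))" "span (w ` {..<r}) = UNIV"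
      using B by (simp add: strongly_completely_decomposable_def) blast
    show ?thesis
      by (rule strong[OF A w(1) nonzero_coordinate_of_spanning[OF w(2)]])
  qed
  ultimately show ?thesis
    using weak by blast
qed

end
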